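(* Let $s$ be the maximal real solution, defined on the open interval $I \subseteq \mathbb{R}$ containing $0$, of the initial value problem $\ddot{s}(t) = 6 s(t)^2 + 6t$, $s(0) = \dot{s}(0) = 0$. If $\tau > 0$ is an arbitrary positive element of $I$, then $\tau + s(\tau)^{-1/2}$ lies outside $I$.
   Context: Dots denote derivatives with respect to the real variable $t$. The interval $I$ is the maximal open interval about $0$ on which the (unique) real solution $s$ of the initial value problem exists. For every $t > 0$ in $I$ one has $s(t) > 0$, so $s(\tau)^{-1/2}$ is meaningful. *)

theory Defs
  imports "HOL-Analysis.Analysis"
begin

(* Functions are total, so u is only constrained on J; since J is open, "deriv u" on J
   depends only on the values of u on J. *)
definition is_solution :: "(real \<Rightarrow> real) \<Rightarrow> real set \<Rightarrow> bool" where
  "is_solution u J \<longleftrightarrow>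
     open J \<and> is_interval J \<and> 0 \<in> J \<and>
     u 0 = 0 \<and> deriv u 0 = 0 \<and>
     (\<forall>t\<in>J. u differentiable (at t) \<and>
            (deriv u has_real_derivative (6 * (u t)\<^sup>2 + 6 * t)) (at t))"

definition is_maximal_solution :: "(real \<Rightarrow> real) \<Rightarrow> real set \<Rightarrow> bool" where
  "is_maximal_solution s I \<longleftrightarrow>
     is_solution s I \<and>
     (\<forall>u J. is_solution u J \<and> I \<subseteq> J \<and> (\<forall>t\<in>I. u t = s t) \<longrightarrow> J = I)"

end

theory Submission
  imports Defs
begin

text \<open>
  The energy \<open>s'\<^sup>2 - 4 s\<^sup>3\<close> has derivative \<open>12 t s'\<close>, so it is nonnegative for \<open>t \<ge> 0\<close>. Hence
  \<open>s' \<ge> 2 (sqrt s)\<^sup>3\<close>, which says that \<open>1 / sqrt s + t\<close> is nonincreasing. If the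
  solution survived up to \<open>\<tau> + 1 / sqrt (s \<tau>)\<close>, then \<open>1 / sqrt s\<close> would be at most \<open>0\<close> there.
\<close>

text \<open>For \<open>t > 0\<close> the equation gives \<open>s'' = 6 s\<^sup>2 + 6 t > 0\<close>,
  so \<open>s'\<close>, and then \<open>s\<close>, increases strictly from its value 0 at the
  origin. Positivity of \<open>s'\<close> is in turn what makes the energy nondecreasing, starting
  from the value 0.\<close>

lemma solution_energy_bounds:
  assumes sol: "is_solution s I" and "t \<in> I" "t > 0"
  shows "deriv s t > 0" "s t > 0" "(deriv s t)\<^sup>2 \<ge> 4 * s t ^ 3"
proof -
  have "0 \<in> I" and s0: "s 0 = 0" "deriv s 0 = 0" and "is_interval I"
    using sol by (auto simp: is_solution_def)
  then have sub: "x \<in> I" if "0 \<le> x" "x \<le> t" for x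
    using mem_is_interval_1_I[of I 0 t x] that \<open>t \<in> I\<close> by blast
  have D1: "(s has_real_derivative deriv s x) (at x)" if "x \<in> I" for x
    using sol that by (auto simp: is_solution_def DERIV_deriv_iff_real_differentiable)
  have D2: "(deriv s has_real_derivative 6 * (s x)\<^sup>2 + 6 * x) (at x)" if "x \<in> I" for x
    using sol that by (auto simp: is_solution_def)
  have c1: "continuous_on {0..x} s" and c2: "continuous_on {0..x} (deriv s)" if "x \<le> t" for x
    using that by (auto intro!: continuous_at_imp_continuous_on DERIV_isCont[OF D1]
        DERIV_isCont[OF D2] sub)
  have pos': "deriv s x > 0" if "0 < x" "x \<le> t" for x
  proof -
    \<comment> \<open>The second derivative vanishes at 0, so strict positivity is available only in
      the interior; continuity takes care of the endpoints.\<close>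
    have "deriv s 0 < deriv s x"
    proof (rule DERIV_pos_imp_increasing_open[OF \<open>0 < x\<close> _ c2[OF \<open>x \<le> t\<close>]])
      fix y assume "0 < y" "y < x"
      then show "\<exists>d. (deriv s has_real_derivative d) (at y) \<and> 0 < d"
        using D2[OF sub, of y] that by (intro exI[of _ "6 * (s y)\<^sup>2 + 6 * y"]) (auto intro: add_nonneg_pos)
    qed
    then show ?thesis using s0 by simp
  qed
  show "deriv s t > 0" using pos' \<open>t > 0\<close> by simp
  have "s 0 < s t"
  proof (rule DERIV_pos_imp_increasing_open[OF \<open>0 < t\<close> _ c1[OF order_refl]])
    fix y assume "0 < y" "y < t"
    then show "\<exists>d. (s has_real_derivative d) (at y) \<and> 0 < d"
      using D1[OF sub, of y] pos'[of y] by auto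
  qed
  then show "s t > 0" using s0 by simp
  have "(deriv s 0)\<^sup>2 - 4 * s 0 ^ 3 \<le> (deriv s t)\<^sup>2 - 4 * s t ^ 3"
  proof (rule DERIV_nonneg_imp_increasing_open[where f = "\<lambda>x. (deriv s x)\<^sup>2 - 4 * s x ^ 3"])
    show "0 \<le> t" using \<open>t > 0\<close> by simp
    show "continuous_on {0..t} (\<lambda>x. (deriv s x)\<^sup>2 - 4 * s x ^ 3)"
      using c1 c2 by (intro continuous_intros) auto
    fix y assume y: "0 < y" "y < t"
    then have "y \<in> I" by (simp add: sub)
    \<comment> \<open>The terms in \<open>s\<^sup>2 s'\<close> cancel:
      \<open>2 s' (6 s\<^sup>2 + 6 y) - 12 s\<^sup>2 s' = 12 y s'\<close>.\<close>
    have "((\<lambda>x. (deriv s x)\<^sup>2 - 4 * s x ^ 3) has_real_derivative 12 * y * deriv s y) (at y)"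
      by (rule derivative_eq_intros D1 D2 \<open>y \<in> I\<close> refl)+ (simp add: algebra_simps)
    then show "\<exists>d. ((\<lambda>x. (deriv s x)\<^sup>2 - 4 * s x ^ 3) has_real_derivative d) (at y) \<and> 0 \<le> d"
      using y pos'[of y] by (intro exI[of _ "12 * y * deriv s y"]) auto
  qed
  then show "(deriv s t)\<^sup>2 \<ge> 4 * s t ^ 3" using s0 by simp
qed

text \<open>With \<open>r = sqrt s\<close>, the derivative of \<open>1 / sqrt s + t\<close> is
  \<open>1 - s' / (2 r ^ 3)\<close>, which is at most 0 exactly when
  \<open>2 r ^ 3 \<le> s'\<close>.\<close>

lemma antimono_inverse_sqrt_solution:
  assumes sol: "is_solution s I" and "a \<in> I" "b \<in> I" "0 < a" "a \<le> b"
  shows "inverse (sqrt (s b)) + b \<le> inverse (sqrt (s a)) + a"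
proof (rule DERIV_nonpos_imp_nonincreasing[OF \<open>a \<le> b\<close>, where f = "\<lambda>x. inverse (sqrt (s x)) + x"])
  fix x assume x: "a \<le> x" "x \<le> b"
  have "x \<in> I"
    using sol mem_is_interval_1_I[of I a b x] x \<open>a \<in> I\<close> \<open>b \<in> I\<close> unfolding is_solution_def by blast
  note bounds = solution_energy_bounds[OF sol this, OF order.strict_trans2[OF \<open>0 < a\<close> x(1)]]
  have D: "(s has_real_derivative deriv s x) (at x)"
    using sol \<open>x \<in> I\<close> by (auto simp: is_solution_def DERIV_deriv_iff_real_differentiable)
  define r where "r = sqrt (s x)"
  have r: "r > 0" "s x = r\<^sup>2" using bounds by (simp_all add: r_def)
  \<comment> \<open>This is the energy bound, since \<open>4 s ^ 3 = (2 r ^ 3)\<^sup>2\<close>; the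
    sign of \<open>s'\<close> then allows taking square roots.\<close>
  have "(2 * r ^ 3)\<^sup>2 \<le> (deriv s x)\<^sup>2"
    using bounds(3) by (simp add: r power_mult_distrib flip: power_mult)
  then have ge: "2 * r ^ 3 \<le> deriv s x"
    using bounds(1) by (auto intro: power2_le_imp_le)
  have "((\<lambda>x. inverse (sqrt (s x)) + x) has_real_derivative 1 - deriv s x / (2 * r ^ 3)) (at x)"
    by (rule DERIV_cong[OF DERIV_add[OF DERIV_inverse'[OF
          DERIV_chain2[OF DERIV_real_sqrt[OF bounds(2)] D]] DERIV_ident]])
      (use r in \<open>simp_all add: field_simps power3_eq_cube\<close>)
  then show "\<exists>d. ((\<lambda>x. inverse (sqrt (s x)) + x) has_real_derivative d) (at x) \<and> d \<le> 0"
    using ge r by (intro exI[of _ "1 - deriv s x / (2 * r ^ 3)"]) (auto simp: field_simps)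
qed

theorem theorem1:
  fixes s :: "real \<Rightarrow> real" and I :: "real set" and \<tau> :: real
  assumes "is_maximal_solution s I"
    and "\<tau> \<in> I" and "\<tau> > 0"
  shows "\<tau> + s \<tau> powr (- 1 / 2) \<notin> I"
proof
  define T where "T = \<tau> + s \<tau> powr (- 1 / 2)"
  assume "\<tau> + s \<tau> powr (- 1 / 2) \<in> I"
  then have "T \<in> I" by (simp add: T_def)
  have sol: "is_solution s I" using assms(1) by (simp add: is_maximal_solution_def)
  have "s \<tau> > 0" by (rule solution_energy_bounds(2)[OF sol assms(2,3)])
  then have T: "T = \<tau> + inverse (sqrt (s \<tau>))"
    by (simp add: T_def powr_minus powr_half_sqrt)
  then have "\<tau> \<le> T" using \<open>s \<tau> > 0\<close> by simp
  then have "s T > 0"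
    using solution_energy_bounds(2)[OF sol \<open>T \<in> I\<close>] assms(3) by simp
  \<comment> \<open>By the choice of \<open>T\<close>, the value of \<open>1 / sqrt s + t\<close> at
    \<open>\<tau>\<close> is \<open>T\<close> itself, so the two occurrences of \<open>T\<close>
    cancel.\<close>
  moreover have "inverse (sqrt (s T)) \<le> 0"
    using antimono_inverse_sqrt_solution[OF sol assms(2) \<open>T \<in> I\<close> assms(3) \<open>\<tau> \<le> T\<close>] T by simp
  ultimately show False by simp
qed

end
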